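(* Let $\sigma$ be an erasing $k$-block substitution with $w_\epsilon\ne1^k$ that satisfies the optimality condition. Let $y\in\mathbb I$ be a point with the following property: for each $w\in\{0,1\}^\omega$ with $y=0.w$, the sequence of blocks $(b_i)_{i\ge1}$ with $w=\prod_{i\ge1}\sigma(b_i)$ and $\sigma(b_i)\neq\epsilon$ for all $i$ is unique. If moreover $y$ is not a dyadic rational, then the closure of $f_\sigma^{-1}(y)$ in $\mathbb I$ is a Cantor space, i.e. a nonempty, compact, perfect, totally disconnected (nowhere dense) subset of $\mathbb I$.
   Context: Notation: $\mathbb I=[0,1]$. $\{0,1\}^*$ and $\{0,1\}^\omega$ denote finite and infinite binary words, and $\epsilon$ is the empty word. For a word $w$, set $0.w=\sum_iw_i2^{-i}$. For $x\in(0,1]$, $\widetilde x$ is the unique infinite binary expansion of $x$ not ending in $0^\infty$. Fix $k\ge2$. An erasing $k$-block substitution is a map $\sigma:\{0,1\}^k\to\{0,1\}^*$ with exactly one block $w_\epsilon$ such that $\sigma(w_\epsilon)=\epsilon$. It acts blockwise on infinite words, concatenating the images of consecutive $k$-blocks. The map $f_\sigma:\mathbb I\to\mathbb I$ is defined by $f_\sigma(x)=0.\sigma(\widetilde x)$ if $x\in(0,1]$ and $\widetilde x\neq w_\epsilon^\infty$, and $f_\sigma(x)=0$ otherwise. Optimality condition: every $w\in\{0,1\}^\omega$ can be written as $w=\prod_{i\ge1}\sigma(b_i)$ with blocks $b_i\in\{0,1\}^k$ satisfying $\sigma(b_i)\ne\epsilon$. *)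

theory Defs
  imports "HOL-Analysis.Analysis"
begin

text \<open>Binary words: finite words are bool lists (True = 1), infinite words are
  functions nat \<Rightarrow> bool, indexed from 0 (position n corresponds to digit n+1).\<close>

definition bin_val :: "(nat \<Rightarrow> bool) \<Rightarrow> real" where
  "bin_val w = (\<Sum>n. (if w n then 1 else 0) / 2 ^ (Suc n))"

definition fin_val :: "bool list \<Rightarrow> real" where
  "fin_val u = (\<Sum>j<length u. (if u ! j then 1 else 0) / 2 ^ (Suc j))"

definition tilde :: "real \<Rightarrow> (nat \<Rightarrow> bool)" where
  "tilde x = (THE w. bin_val w = x \<and> (\<forall>n. \<exists>m>n. w m))"

definition block :: "nat \<Rightarrow> (nat \<Rightarrow> bool) \<Rightarrow> nat \<Rightarrow> bool list" where
  "block k w i = map w [i * k..<i * k + k]"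

definition erasing_block_subst :: "nat \<Rightarrow> (bool list \<Rightarrow> bool list) \<Rightarrow> bool" where
  "erasing_block_subst k \<sigma> \<longleftrightarrow> (\<exists>!b. length b = k \<and> \<sigma> b = [])"

definition w_eps :: "nat \<Rightarrow> (bool list \<Rightarrow> bool list) \<Rightarrow> bool list" where
  "w_eps k \<sigma> = (THE b. length b = k \<and> \<sigma> b = [])"

definition start_pos :: "(nat \<Rightarrow> bool list) \<Rightarrow> nat \<Rightarrow> nat" where
  "start_pos ws i = (\<Sum>j<i. length (ws j))"

definition inf_concat_eq :: "(nat \<Rightarrow> bool) \<Rightarrow> (nat \<Rightarrow> bool list) \<Rightarrow> bool" where
  "inf_concat_eq w ws \<longleftrightarrow> (\<forall>i. ws i \<noteq> []) \<and>
     (\<forall>i j. j < length (ws i) \<longrightarrow> w (start_pos ws i + j) = ws i ! j)"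

definition sigma_decomp ::
  "nat \<Rightarrow> (bool list \<Rightarrow> bool list) \<Rightarrow> (nat \<Rightarrow> bool) \<Rightarrow> (nat \<Rightarrow> bool list) \<Rightarrow> bool" where
  "sigma_decomp k \<sigma> w b \<longleftrightarrow> (\<forall>i. length (b i) = k \<and> \<sigma> (b i) \<noteq> []) \<and>
     inf_concat_eq w (\<lambda>i. \<sigma> (b i))"

definition optimal :: "nat \<Rightarrow> (bool list \<Rightarrow> bool list) \<Rightarrow> bool" where
  "optimal k \<sigma> \<longleftrightarrow> (\<forall>w. \<exists>b. sigma_decomp k \<sigma> w b)"

text \<open>0.\<sigma>(w): value of the (possibly finite) concatenation of the images of the
  k-blocks of w, computed factor by factor.\<close>
definition sigma_val :: "nat \<Rightarrow> (bool list \<Rightarrow> bool list) \<Rightarrow> (nat \<Rightarrow> bool) \<Rightarrow> real" where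
  "sigma_val k \<sigma> w =
     (\<Sum>i. fin_val (\<sigma> (block k w i)) / 2 ^ start_pos (\<lambda>j. \<sigma> (block k w j)) i)"

definition f_sigma :: "nat \<Rightarrow> (bool list \<Rightarrow> bool list) \<Rightarrow> real \<Rightarrow> real" where
  "f_sigma k \<sigma> x =
     (if 0 < x \<and> x \<le> 1 \<and> tilde x \<noteq> (\<lambda>n. w_eps k \<sigma> ! (n mod k))
      then sigma_val k \<sigma> (tilde x) else 0)"

definition dyadic_rational :: "real \<Rightarrow> bool" where
  "dyadic_rational y \<longleftrightarrow> (\<exists>(m::int) (n::nat). y = of_int m / 2 ^ n)"

definition cantor_space :: "real set \<Rightarrow> bool" where
  "cantor_space S \<longleftrightarrow> S \<noteq> {} \<and> compact S \<and> (\<forall>x\<in>S. x islimpt S) \<and>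
     (\<forall>C\<subseteq>S. connected C \<longrightarrow> (\<forall>a\<in>C. \<forall>b\<in>C. a = b)) \<and> interior S = {}"

end

(* Since y is not dyadic, the fibre consists of the values of those words u with infinitely many ones
   whose sequence of nonerased blocks is the unique decomposition b of the expansion of y; only the
   positions of the erased block between the b_i are free. Inserting one more erased block far out
   keeps the image and moves the point only slightly, so the fibre has no isolated point. At a
   position far out, only the erased block or the next b_i can occur, while there are at least four
   blocks of length k; a third choice yields a cylinder missing the fibre, which is therefore nowhere
   dense. On the line this also gives total disconnectedness. *)
theory Submission
  imports Defs
begin

section \<open>Dyadic rationals\<close>

lemma dyadic_rational_of_int: "dyadic_rational (of_int m)"
  unfolding dyadic_rational_def by (rule exI[of _ m], rule exI[of _ 0]) simp

lemma dyadic_rational_add: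
  assumes "dyadic_rational x" "dyadic_rational y"
  shows "dyadic_rational (x + y)"
proof -
  obtain m n m' n' where "x = of_int m / 2 ^ n" "y = of_int m' / 2 ^ n'"
    using assms unfolding dyadic_rational_def by blast
  then have "x + y = of_int (m * 2 ^ n' + m' * 2 ^ n) / 2 ^ (n + n')"
    by (simp add: add_divide_distrib power_add)
  then show ?thesis unfolding dyadic_rational_def by blast
qed

lemma dyadic_rational_half: "dyadic_rational x \<Longrightarrow> dyadic_rational (x / 2)"
  unfolding dyadic_rational_def
proof (elim exE)
  fix m n assume "x = of_int m / 2 ^ n"
  then have "x / 2 = of_int m / 2 ^ Suc n" by simp
  then show "\<exists>m n. x / 2 = of_int m / 2 ^ n" by blast
qed

lemma dyadic_rational_divide_power: "dyadic_rational x \<Longrightarrow> dyadic_rational (x / 2 ^ n)"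
proof (induction n)
  case (Suc n)
  then show ?case using dyadic_rational_half[of "x / 2 ^ n"] by (simp add: mult.commute)
qed simp

text \<open>Doubling and subtracting \<open>c\<close> undoes the map. With \<open>c\<close> a digit,
  this carries dyadicity and nondyadicity along tails of a word.\<close>

lemma dyadic_rational_half_shift:
  "dyadic_rational ((of_int c + x) / 2) \<longleftrightarrow> dyadic_rational x"
proof
  assume "dyadic_rational ((of_int c + x) / 2)"
  from dyadic_rational_add[OF dyadic_rational_add[OF this this] dyadic_rational_of_int[of "- c"]]
  show "dyadic_rational x" by simp
next
  assume "dyadic_rational x"
  then show "dyadic_rational ((of_int c + x) / 2)"
    by (intro dyadic_rational_half dyadic_rational_add dyadic_rational_of_int)
qed

section \<open>Values of infinite words\<close>

lemma bin_val_summable: "summable (\<lambda>n. (if w n then 1 else 0 :: real) / 2 ^ Suc n)"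
proof (rule summable_comparison_test')
  show "summable (\<lambda>n. (1/2 :: real) ^ Suc n)" by (simp add: summable_Suc_iff)
  show "norm ((if w n then 1 else 0 :: real) / 2 ^ Suc n) \<le> (1/2) ^ Suc n" for n
    by (simp add: power_divide)
qed

text \<open>The unrolling behind most inductions on words: one digit is peeled off and the word is
  generalised to its tail.\<close>

lemma bin_val_rec: "bin_val w = ((if w 0 then 1 else 0) + bin_val (\<lambda>n. w (Suc n))) / 2"
proof -
  have "bin_val w = (if w 0 then 1 else 0) / 2 + (\<Sum>n. (if w (Suc n) then 1 else 0 :: real) / 2 ^ Suc (Suc n))"
    unfolding bin_val_def using suminf_split_head[OF bin_val_summable[of w]] by simp
  also have "(\<Sum>n. (if w (Suc n) then 1 else 0 :: real) / 2 ^ Suc (Suc n))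
      = (\<Sum>n. (if w (Suc n) then 1 else 0 :: real) / 2 ^ Suc n / 2)"
    by (intro suminf_cong) simp
  also have "\<dots> = bin_val (\<lambda>n. w (Suc n)) / 2"
    unfolding bin_val_def by (rule suminf_divide[OF bin_val_summable[of "\<lambda>n. w (Suc n)"]])
  finally show ?thesis by (simp add: add_divide_distrib)
qed

lemma bin_val_nonneg: "0 \<le> bin_val w"
  unfolding bin_val_def by (intro suminf_nonneg bin_val_summable) simp

lemma bin_val_le_1: "bin_val w \<le> 1"
proof -
  have s: "(\<lambda>n. (1/2 :: real) ^ Suc n) sums 1"
    by (rule power_half_series)
  have "bin_val w \<le> (\<Sum>n. (1/2 :: real) ^ Suc n)"
    unfolding bin_val_def
    by (intro suminf_le bin_val_summable sums_summable[OF s]) (simp add: power_divide)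
  then show ?thesis using sums_unique[OF s] by simp
qed

lemma bin_val_pos: "w n \<Longrightarrow> 0 < bin_val w"
proof (induction n arbitrary: w)
  case 0
  then show ?case using bin_val_nonneg[of "\<lambda>n. w (Suc n)"] by (subst bin_val_rec) simp
next
  case (Suc n)
  then show ?case by (subst bin_val_rec) (simp add: add_nonneg_pos)
qed

lemma bin_val_diff_le:
  assumes "\<And>i. i < n \<Longrightarrow> u i = v i"
  shows "\<bar>bin_val u - bin_val v\<bar> \<le> 1 / 2 ^ n"
  using assms
proof (induction n arbitrary: u v)
  case 0
  then show ?case using bin_val_nonneg[of u] bin_val_nonneg[of v] bin_val_le_1[of u] bin_val_le_1[of v]
    by (simp add: abs_le_iff)
next
  case (Suc n)
  have "\<bar>bin_val (\<lambda>i. u (Suc i)) - bin_val (\<lambda>i. v (Suc i))\<bar> \<le> 1 / 2 ^ n"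
    by (rule Suc.IH) (simp add: Suc.prems)
  moreover have "bin_val u - bin_val v = (bin_val (\<lambda>i. u (Suc i)) - bin_val (\<lambda>i. v (Suc i))) / 2"
    using Suc.prems[of 0] by (subst (1 2) bin_val_rec) (simp add: field_simps)
  ultimately show ?case by (simp add: abs_divide)
qed

lemma dyadic_bin_val_Suc: "dyadic_rational (bin_val (\<lambda>n. w (Suc n))) \<longleftrightarrow> dyadic_rational (bin_val w)"
  using dyadic_rational_half_shift[of "if w 0 then 1 else 0" "bin_val (\<lambda>n. w (Suc n))"]
  by (subst (2) bin_val_rec) (simp split: if_splits)

lemma dyadic_bin_val_shift: "dyadic_rational (bin_val (\<lambda>n. w (n + m))) \<longleftrightarrow> dyadic_rational (bin_val w)"
proof (induction m)
  case (Suc m)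
  then show ?case using dyadic_bin_val_Suc[of "\<lambda>n. w (n + m)"] by simp
qed simp

text \<open>The digits 0 and 1 put the value in [0, 1/2] and [1/2, 1], which meet only in the dyadic
  point 1/2. The remainder \<open>r\<close> is an arbitrary real, not yet known to be the value of a
  word, so that block values can be substituted later.\<close>

lemma bin_val_half_head:
  assumes "bin_val w = (c + r) / 2" "c = (if a then 1 else 0)" "0 \<le> r" "r \<le> 1"
    "\<not> dyadic_rational (bin_val w)"
  shows "w 0 = a" "bin_val (\<lambda>n. w (Suc n)) = r"
proof -
  have "bin_val w \<noteq> 1 / 2"
    using assms(5) dyadic_rational_half[OF dyadic_rational_of_int[of 1]] by (metis of_int_1)
  then show "w 0 = a"
    using bin_val_rec[of w] bin_val_nonneg[of "\<lambda>n. w (Suc n)"] bin_val_le_1[of "\<lambda>n. w (Suc n)"] assms(1-4)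
    by (auto split: if_splits)
  then show "bin_val (\<lambda>n. w (Suc n)) = r"
    using bin_val_rec[of w] assms(1,2) by (simp split: if_splits)
qed

text \<open>A nondyadic value has positive distance from 1/2, which fixes the first digit of all
  nearby words; dropping that digit keeps the value nondyadic and doubles distances.\<close>

lemma nondyadic_digits_locally_constant:
  assumes "\<not> dyadic_rational (bin_val u)"
  shows "\<exists>\<delta>>0. \<forall>v. \<bar>bin_val v - bin_val u\<bar> < \<delta> \<longrightarrow> (\<forall>i<n. v i = u i)"
  using assms
proof (induction n arbitrary: u)
  case 0
  then show ?case by (intro exI[of _ 1]) simp
next
  case (Suc n)
  obtain \<delta> where \<delta>: "\<delta> > 0" "\<And>v. \<bar>bin_val v - bin_val (\<lambda>i. u (Suc i))\<bar> < \<delta> \<Longrightarrow> \<forall>i<n. v i = u (Suc i)"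
    using Suc.IH[of "\<lambda>i. u (Suc i)"] Suc.prems dyadic_bin_val_Suc by blast
  have ne: "bin_val u \<noteq> 1 / 2"
    using Suc.prems dyadic_rational_half[OF dyadic_rational_of_int[of 1]] by (metis of_int_1)
  \<comment> \<open>The first bound keeps both values on the same side of 1/2; the second is halved
    because removing the common digit doubles the difference.\<close>
  let ?e = "min \<bar>bin_val u - 1/2\<bar> (\<delta> / 2)"
  have "\<forall>i<Suc n. v i = u i" if v: "\<bar>bin_val v - bin_val u\<bar> < ?e" for v
  proof -
    let ?v = "\<lambda>i. v (Suc i)" and ?u = "\<lambda>i. u (Suc i)"
    note r = bin_val_rec[of u] bin_val_rec[of v]
    note b = bin_val_nonneg[of ?u] bin_val_nonneg[of ?v] bin_val_le_1[of ?u] bin_val_le_1[of ?v]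
    have h: "v 0 = u 0"
      using v r b by (cases "u 0"; cases "v 0"; simp; arith)
    then have "bin_val ?v - bin_val ?u = 2 * (bin_val v - bin_val u)"
      using r by (simp split: if_splits)
    then have "\<bar>bin_val ?v - bin_val ?u\<bar> = 2 * \<bar>bin_val v - bin_val u\<bar>"
      by (simp only: abs_mult abs_numeral)
    then have "\<bar>bin_val ?v - bin_val ?u\<bar> < \<delta>" using v by simp
    from \<delta>(2)[OF this] h show ?thesis by (auto simp: less_Suc_eq_0_disj)
  qed
  moreover have "?e > 0" using \<delta>(1) ne by simp
  ultimately show ?case by blast
qed

section \<open>Expansions with infinitely many ones\<close>

text \<open>Tails are strictly positive, so a leading 1 gives a value above 1/2 and a leading 0 at
  most 1/2; the digits are forced one after another.\<close>

lemma bin_val_inj_infinitely_many_ones: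
  assumes "bin_val u = bin_val v" "\<forall>n. \<exists>m>n. u m" "\<forall>n. \<exists>m>n. v m"
  shows "u = v"
proof -
  have "u n = v n" for n
    using assms
  proof (induction n arbitrary: u v)
    case (0 u v)
    have "0 < bin_val (\<lambda>n. u (Suc n))" "0 < bin_val (\<lambda>n. v (Suc n))"
      using "0.prems"(2,3) by (metis Suc_pred' bin_val_pos)+
    moreover note bin_val_le_1[of "\<lambda>n. u (Suc n)"] bin_val_le_1[of "\<lambda>n. v (Suc n)"]
    ultimately show ?case
      using bin_val_rec[of u] bin_val_rec[of v] "0.prems"(1) by (auto split: if_splits)
  next
    case (Suc n u v)
    have tails: "\<forall>n. \<exists>m>n. u (Suc m)" "\<forall>n. \<exists>m>n. v (Suc m)"
      using Suc.prems(2,3) by (metis Suc_lessE Suc_less_eq)+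
    have "u 0 = v 0"
    proof -
      have "0 < bin_val (\<lambda>n. u (Suc n))" "0 < bin_val (\<lambda>n. v (Suc n))"
        using tails by (metis bin_val_pos)+
      moreover note bin_val_le_1[of "\<lambda>n. u (Suc n)"] bin_val_le_1[of "\<lambda>n. v (Suc n)"]
      ultimately show ?thesis
        using bin_val_rec[of u] bin_val_rec[of v] Suc.prems(1) by (auto split: if_splits)
    qed
    then have "bin_val (\<lambda>n. u (Suc n)) = bin_val (\<lambda>n. v (Suc n))"
      using bin_val_rec[of u] bin_val_rec[of v] Suc.prems(1) by simp
    from Suc.IH[OF this tails] show ?case .
  qed
  then show ?thesis by blast
qed

lemma ex_expansion_infinitely_many_ones:
  fixes x :: real
  assumes "0 < x" "x \<le> 1"
  shows "\<exists>w. bin_val w = x \<and> (\<forall>n. \<exists>m>n. w m)"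
proof -
  \<comment> \<open>The doubling map, with 1/2 sent to 1 so that (0,1] is mapped to itself. The
    digits record when the orbit of \<open>x\<close> lies above 1/2.\<close>
  define T where "T z = (if z > 1/2 then 2 * z - 1 else 2 * z)" for z :: real
  define g where "g n = (T ^^ n) x" for n
  have g: "0 < g n \<and> g n \<le> 1" for n
    using assms by (induction n) (auto simp: g_def T_def)
  have val: "bin_val (\<lambda>i. g (i + n) > 1/2) = g n" for n
  proof -
    \<comment> \<open>Value and orbit obey the same recursion, so the error at \<open>n\<close> is
      half the error at \<open>Suc n\<close>; \<open>m\<close> halvings of an error at most 1 give
      the bound.\<close>
    have "\<bar>bin_val (\<lambda>i. g (i + n) > 1/2) - g n\<bar> \<le> 1 / 2 ^ m" for m
    proof (induction m arbitrary: n)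
      case 0
      show ?case
        using g[of n] bin_val_nonneg[of "\<lambda>i. g (i + n) > 1/2"] bin_val_le_1[of "\<lambda>i. g (i + n) > 1/2"]
        by (simp add: abs_le_iff)
    next
      case (Suc m)
      define c :: real where "c = (if g n > 1/2 then 1 else 0)"
      have "g n = (c + g (Suc n)) / 2"
        by (simp add: c_def g_def T_def)
      moreover have "bin_val (\<lambda>i. g (i + n) > 1/2) = (c + bin_val (\<lambda>i. g (i + Suc n) > 1/2)) / 2"
        unfolding c_def by (subst bin_val_rec) simp
      ultimately have "bin_val (\<lambda>i. g (i + n) > 1/2) - g n
          = (bin_val (\<lambda>i. g (i + Suc n) > 1/2) - g (Suc n)) / 2"
        by (simp add: add_divide_distrib diff_divide_distrib)
      then show ?case using Suc.IH[of "Suc n"] by (simp add: abs_divide)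
    qed
    note bound = this
    have "(\<lambda>m. 1 / 2 ^ m :: real) \<longlonglongrightarrow> 0"
      using LIMSEQ_power_zero[of "1/2 :: real"] by (simp add: power_divide)
    from LIMSEQ_le_const[OF this] bound have "\<bar>bin_val (\<lambda>i. g (i + n) > 1/2) - g n\<bar> \<le> 0"
      by blast
    then show ?thesis by simp
  qed
  \<comment> \<open>Digits vanishing from some point on would make an orbit point 0.\<close>
  have "\<exists>m>n. g m > 1/2" for n
  proof (rule ccontr)
    assume "\<not> (\<exists>m>n. g m > 1/2)"
    then have "(\<lambda>i. g (i + Suc n) > 1/2) = (\<lambda>i. False)" by auto
    then have "g (Suc n) = bin_val (\<lambda>i. False)" using val[of "Suc n"] by metis
    then show False using g[of "Suc n"] by (simp add: bin_val_def)
  qed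
  moreover have "bin_val (\<lambda>i. g i > 1/2) = x" using val[of 0] by (simp add: g_def)
  ultimately show ?thesis by blast
qed

lemma tilde_bin_val:
  assumes "\<forall>n. \<exists>m>n. u m"
  shows "tilde (bin_val u) = u"
  unfolding tilde_def
proof (rule the_equality)
  fix w assume "bin_val w = bin_val u \<and> (\<forall>n. \<exists>m>n. w m)"
  then show "w = u" using assms by (intro bin_val_inj_infinitely_many_ones) auto
qed (use assms in simp)

lemma tilde_expansion:
  assumes "0 < x" "x \<le> 1"
  shows "bin_val (tilde x) = x" "\<forall>n. \<exists>m>n. tilde x m"
proof -
  obtain w where w: "bin_val w = x" "\<forall>n. \<exists>m>n. w m"
    using ex_expansion_infinitely_many_ones[OF assms] by blast
  then have "tilde x = w" using tilde_bin_val by blast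
  then show "bin_val (tilde x) = x" "\<forall>n. \<exists>m>n. tilde x m" using w by simp_all
qed

section \<open>Values of sequences of finite words\<close>

text \<open>This is \<open>sigma_val\<close> freed from the blocks of a word. Empty factors are
  allowed, even all but finitely many, so factors can be peeled off, deleted or inserted.\<close>

definition block_val :: "(nat \<Rightarrow> bool list) \<Rightarrow> real" where
  "block_val ws = (\<Sum>i. fin_val (ws i) / 2 ^ start_pos ws i)"

lemma sigma_val_eq_block_val: "sigma_val k \<sigma> u = block_val (\<lambda>i. \<sigma> (block k u i))"
  by (simp add: sigma_val_def block_val_def)

lemma fin_val_Nil [simp]: "fin_val [] = 0"
  by (simp add: fin_val_def)

lemma fin_val_Cons: "fin_val (a # p) = ((if a then 1 else 0) + fin_val p) / 2"
  by (simp add: fin_val_def sum.lessThan_Suc_shift add_divide_distrib sum_divide_distrib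
      del: sum.lessThan_Suc)

lemma fin_val_nonneg: "0 \<le> fin_val p"
  by (simp add: fin_val_def sum_nonneg)

lemma fin_val_le: "fin_val p \<le> 1 - 1 / 2 ^ length p"
proof (induction p)
  case (Cons a p)
  have "fin_val (a # p) \<le> (1 + fin_val p) / 2" by (simp add: fin_val_Cons)
  also have "\<dots> \<le> (1 + (1 - 1 / 2 ^ length p)) / 2" using Cons.IH by (intro divide_right_mono) auto
  also have "\<dots> = 1 - 1 / 2 ^ length (a # p)" by (simp add: field_simps)
  finally show ?case .
qed simp

lemma dyadic_fin_val: "dyadic_rational (fin_val p)"
proof (induction p)
  case Nil
  then show ?case using dyadic_rational_of_int[of 0] by simp
next
  case (Cons a p)
  then show ?case
    using dyadic_rational_half_shift[of "if a then 1 else 0" "fin_val p"]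
    by (simp add: fin_val_Cons split: if_splits)
qed

lemma start_pos_Suc_shift:
  "start_pos ws (Suc i) = length (ws 0) + start_pos (\<lambda>i. ws (Suc i)) i"
  by (simp add: start_pos_def sum.lessThan_Suc_shift del: sum.lessThan_Suc)

text \<open>By \<open>fin_val_le\<close> each term is at most the drop of
  \<open>1 / 2 ^ start_pos ws i\<close> from \<open>i\<close> to \<open>Suc i\<close>, so the bound
  telescopes. It yields both summability and the upper bound 1.\<close>

lemma block_val_partial_le:
  "(\<Sum>i<n. fin_val (ws i) / 2 ^ start_pos ws i) \<le> 1 - 1 / 2 ^ start_pos ws n"
proof (induction n)
  case 0
  then show ?case by (simp add: start_pos_def)
next
  case (Suc n)
  have "fin_val (ws n) / 2 ^ start_pos ws n \<le> (1 - 1 / 2 ^ length (ws n)) / 2 ^ start_pos ws n"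
    by (intro divide_right_mono fin_val_le) simp
  also have "\<dots> = 1 / 2 ^ start_pos ws n - 1 / 2 ^ start_pos ws (Suc n)"
    by (simp add: start_pos_def power_add field_simps)
  finally show ?case using Suc.IH by simp
qed

lemma block_val_summable: "summable (\<lambda>i. fin_val (ws i) / 2 ^ start_pos ws i)"
proof (rule summableI_nonneg_bounded)
  show "(\<Sum>i<n. fin_val (ws i) / 2 ^ start_pos ws i) \<le> 1" for n
    using block_val_partial_le[of ws n] by (smt (verit) divide_nonneg_nonneg zero_le_power)
qed (simp add: fin_val_nonneg)

lemma block_val_nonneg: "0 \<le> block_val ws"
  unfolding block_val_def by (intro suminf_nonneg block_val_summable) (simp add: fin_val_nonneg)

lemma block_val_le_1: "block_val ws \<le> 1"
  unfolding block_val_def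
proof (rule suminf_le_const[OF block_val_summable])
  show "(\<Sum>i<n. fin_val (ws i) / 2 ^ start_pos ws i) \<le> 1" for n
    using block_val_partial_le[of ws n] by (smt (verit) divide_nonneg_nonneg zero_le_power)
qed

lemma block_val_rec:
  "block_val ws = fin_val (ws 0) + block_val (\<lambda>i. ws (Suc i)) / 2 ^ length (ws 0)"
proof -
  let ?t = "\<lambda>i. ws (Suc i)"
  have "block_val ws = fin_val (ws 0) + (\<Sum>i. fin_val (ws (Suc i)) / 2 ^ start_pos ws (Suc i))"
    unfolding block_val_def using suminf_split_head[OF block_val_summable[of ws]]
    by (simp add: start_pos_def)
  also have "(\<Sum>i. fin_val (ws (Suc i)) / 2 ^ start_pos ws (Suc i))
      = (\<Sum>i. fin_val (?t i) / 2 ^ start_pos ?t i / 2 ^ length (ws 0))"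
    by (intro suminf_cong) (simp add: start_pos_Suc_shift power_add)
  also have "\<dots> = block_val ?t / 2 ^ length (ws 0)"
    unfolding block_val_def by (rule suminf_divide[OF block_val_summable])
  finally show ?thesis .
qed

text \<open>Only finitely many digits are contributed. Used contrapositively: a nondyadic image
  needs infinitely many nonerased blocks.\<close>

lemma dyadic_block_val_eventually_Nil:
  assumes "\<forall>i\<ge>n. ws i = []"
  shows "dyadic_rational (block_val ws)"
  using assms
proof (induction n arbitrary: ws)
  case 0
  then have "block_val ws = 0" by (simp add: block_val_def)
  then show ?case using dyadic_rational_of_int[of 0] by simp
next
  case (Suc n)
  then have "dyadic_rational (block_val (\<lambda>i. ws (Suc i)))" by simp
  then show ?case
    by (subst block_val_rec) (intro dyadic_rational_add dyadic_fin_val dyadic_rational_divide_power)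
qed

section \<open>Reading the digits of a concatenation off its value\<close>

lemma bin_val_prefix:
  assumes "\<And>j. j < length p \<Longrightarrow> w j = p ! j"
  shows "bin_val w = fin_val p + bin_val (\<lambda>n. w (n + length p)) / 2 ^ length p"
  using assms
proof (induction p arbitrary: w)
  case (Cons a p)
  have tail: "bin_val (\<lambda>n. w (Suc n)) = fin_val p + bin_val (\<lambda>n. w (Suc (n + length p))) / 2 ^ length p"
    using Cons.IH[of "\<lambda>n. w (Suc n)"] Cons.prems[of "Suc _"] by simp
  have "w 0 = a" using Cons.prems[of 0] by simp
  then have "bin_val w = ((if a then 1 else 0)
      + (fin_val p + bin_val (\<lambda>n. w (Suc (n + length p))) / 2 ^ length p)) / 2"
    using bin_val_rec[of w] tail by simp
  then show ?case by (simp add: fin_val_Cons add_divide_distrib mult.commute)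
qed simp

text \<open>Iterates \<open>bin_val_half_head\<close> along \<open>p\<close>, as a converse of
  \<open>bin_val_prefix\<close>. Dyadic values must be excluded since 0.1000... and 0.0111...
  coincide.\<close>

lemma nondyadic_prefix:
  assumes "bin_val w = fin_val p + r / 2 ^ length p" "0 \<le> r" "r \<le> 1"
    "\<not> dyadic_rational (bin_val w)"
  shows "(\<forall>j<length p. w j = p ! j) \<and> bin_val (\<lambda>n. w (n + length p)) = r"
  using assms
proof (induction p arbitrary: w)
  case (Cons a p)
  let ?r = "fin_val p + r / 2 ^ length p"
  have "r / 2 ^ length p \<le> 1 / 2 ^ length p" "0 \<le> r / 2 ^ length p"
    using Cons.prems by (simp_all add: divide_right_mono)
  then have "0 \<le> ?r" "?r \<le> 1" using fin_val_nonneg[of p] fin_val_le[of p] by simp_all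
  moreover have "bin_val w = ((if a then 1 else 0) + ?r) / 2"
    using Cons.prems(1) by (simp add: fin_val_Cons field_simps)
  ultimately have h: "w 0 = a" "bin_val (\<lambda>n. w (Suc n)) = ?r"
    using bin_val_half_head[of w _ ?r a] Cons.prems(4) by blast+
  have "\<not> dyadic_rational (bin_val (\<lambda>n. w (Suc n)))"
    using Cons.prems(4) by (simp add: dyadic_bin_val_Suc)
  from Cons.IH[OF h(2) Cons.prems(2,3) this] h(1) show ?case
    by (auto simp: less_Suc_eq_0_disj)
qed simp

text \<open>Factors are peeled off one at a time; the tails stay nondyadic, and an empty factor only
  shifts the index. Equality of values thus becomes equality of digits.\<close>

lemma nondyadic_block_val_digits:
  assumes "bin_val w = block_val ws" "\<not> dyadic_rational (bin_val w)" "j < length (ws i)"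
  shows "w (start_pos ws i + j) = ws i ! j"
  using assms
proof (induction i arbitrary: w ws)
  case (0 w ws)
  then have "\<forall>j<length (ws 0). w j = ws 0 ! j"
    using nondyadic_prefix block_val_rec[of ws] block_val_nonneg block_val_le_1 by metis
  then show ?case using "0.prems"(3) by (simp add: start_pos_def)
next
  case (Suc i w ws)
  have "bin_val (\<lambda>n. w (n + length (ws 0))) = block_val (\<lambda>i. ws (Suc i))"
    using Suc.prems(1,2) nondyadic_prefix block_val_rec[of ws] block_val_nonneg block_val_le_1 by metis
  from Suc.IH[OF this] Suc.prems(2,3) show ?case
    by (simp add: dyadic_bin_val_shift start_pos_Suc_shift ac_simps)
qed

text \<open>The partial sums are the value of \<open>w\<close> minus a rescaled tail. Nonempty
  factors make \<open>start_pos ws n\<close> at least \<open>n\<close>, so the tail term tends to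
  0.\<close>

lemma block_val_inf_concat_eq:
  assumes "inf_concat_eq w ws"
  shows "block_val ws = bin_val w"
proof -
  let ?s = "start_pos ws"
  let ?R = "\<lambda>n. bin_val (\<lambda>i. w (i + ?s n)) / 2 ^ ?s n"
  have part: "(\<Sum>i<n. fin_val (ws i) / 2 ^ ?s i) = bin_val w - ?R n" for n
  proof (induction n)
    case 0
    then show ?case by (simp add: start_pos_def)
  next
    case (Suc n)
    have "bin_val (\<lambda>i. w (i + ?s n)) = fin_val (ws n)
        + bin_val (\<lambda>i. w (i + length (ws n) + ?s n)) / 2 ^ length (ws n)"
      using assms by (intro bin_val_prefix) (simp add: inf_concat_eq_def add.commute)
    moreover have s: "?s (Suc n) = length (ws n) + ?s n" by (simp add: start_pos_def)
    ultimately have "?R n = fin_val (ws n) / 2 ^ ?s n + ?R (Suc n)"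
      by (simp add: power_add add_divide_distrib add.assoc)
    then show ?case using Suc.IH by simp
  qed
  have ge: "n \<le> ?s n" for n
  proof (induction n)
    case (Suc n)
    have "0 < length (ws n)" using assms by (simp add: inf_concat_eq_def)
    moreover have "?s (Suc n) = ?s n + length (ws n)" by (simp add: start_pos_def)
    ultimately show ?case using Suc.IH by linarith
  qed simp
  have "?R \<longlonglongrightarrow> 0"
  proof (rule tendsto_sandwich[OF _ _ tendsto_const])
    show "(\<lambda>n. 1 / 2 ^ n :: real) \<longlonglongrightarrow> 0"
      using LIMSEQ_power_zero[of "1/2 :: real"] by (simp add: power_divide)
    show "\<forall>\<^sub>F n in sequentially. ?R n \<le> 1 / 2 ^ n"
      by (intro always_eventually allI frac_le bin_val_le_1 power_increasing ge) auto
  qed (simp add: bin_val_nonneg)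
  then have "(\<lambda>n. bin_val w - ?R n) \<longlonglongrightarrow> bin_val w - 0" by (intro tendsto_intros)
  then have "(\<lambda>i. fin_val (ws i) / 2 ^ ?s i) sums bin_val w"
    by (simp add: sums_def part)
  then show ?thesis by (simp add: block_val_def sums_iff)
qed

section \<open>Deleting empty factors\<close>

lemma start_pos_reindex:
  assumes g: "strict_mono g" and off: "\<And>n. n \<notin> range g \<Longrightarrow> ws n = []"
  shows "start_pos ws (g i) = start_pos (\<lambda>j. ws (g j)) i"
proof -
  have inj: "inj_on g {..<i}" using g by (auto simp: inj_on_def strict_mono_eq)
  have "start_pos ws (g i) = (\<Sum>n\<in>g ` {..<i}. length (ws n))"
    unfolding start_pos_def
  proof (rule sum.mono_neutral_right)
    show "g ` {..<i} \<subseteq> {..<g i}" using g by (auto simp: strict_mono_less)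
    show "\<forall>n\<in>{..<g i} - g ` {..<i}. length (ws n) = 0"
    proof
      fix n assume n: "n \<in> {..<g i} - g ` {..<i}"
      have "n \<notin> range g"
      proof
        assume "n \<in> range g"
        then obtain j where "n = g j" by blast
        then show False using n g by (auto simp: strict_mono_less)
      qed
      then show "length (ws n) = 0" using off by simp
    qed
  qed simp
  also have "\<dots> = start_pos (\<lambda>j. ws (g j)) i"
    by (simp add: start_pos_def sum.reindex[OF inj])
  finally show ?thesis .
qed

text \<open>Empty factors have value 0 and move no start position. This is the freedom in the fibre:
  erased blocks may be inserted or removed.\<close>

lemma block_val_reindex:
  assumes g: "strict_mono g" and off: "\<And>n. n \<notin> range g \<Longrightarrow> ws n = []"
  shows "block_val (\<lambda>j. ws (g j)) = block_val ws"
  unfolding block_val_def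
  using suminf_mono_reindex[OF g, of "\<lambda>n. fin_val (ws n) / 2 ^ start_pos ws n"] off
  by (simp add: start_pos_reindex[OF assms])

text \<open>The elements below \<open>n\<close> are exactly the entries of smaller index. This finds
  the rank of a nonerased block from the blocks before it.\<close>

lemma enumerate_card_below:
  fixes A :: "nat set"
  assumes "infinite A" "n \<in> A"
  shows "enumerate A (card (A \<inter> {..<n})) = n"
proof -
  obtain j where j: "enumerate A j = n" using assms enumerate_Ex by blast
  have sm: "strict_mono (enumerate A)" using assms(1) by (rule strict_mono_enumerate)
  have "A \<inter> {..<n} = enumerate A ` {..<j}"
  proof (intro equalityI subsetI)
    fix x assume x: "x \<in> A \<inter> {..<n}"
    then obtain i where "x = enumerate A i" using range_enumerate[OF assms(1)] by blast
    then show "x \<in> enumerate A ` {..<j}" using x j strict_mono_less[OF sm] by auto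
  qed (use j strict_mono_less[OF sm] enumerate_in_set[OF assms(1)] in auto)
  then have "card (A \<inter> {..<n}) = j"
    using sm by (simp add: card_image inj_on_def strict_mono_eq)
  then show ?thesis using j by simp
qed

section \<open>Words and their blocks\<close>

text \<open>A right inverse of \<open>block\<close> on sequences of length-\<open>k\<close> blocks,
  used to prescribe words of the fibre block by block.\<close>

definition word_of_blocks :: "nat \<Rightarrow> (nat \<Rightarrow> bool list) \<Rightarrow> nat \<Rightarrow> bool" where
  "word_of_blocks k B n = B (n div k) ! (n mod k)"

lemma length_block [simp]: "length (block k u i) = k"
  by (simp add: block_def)

lemma nth_block: "j < k \<Longrightarrow> block k u i ! j = u (i * k + j)"
  by (simp add: block_def)

lemma block_word_of_blocks:
  assumes "length (B i) = k"
  shows "block k (word_of_blocks k B) i = B i"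
proof (rule nth_equalityI)
  fix j assume "j < length (block k (word_of_blocks k B) i)"
  then show "block k (word_of_blocks k B) i ! j = B i ! j" by (simp add: nth_block word_of_blocks_def)
qed (simp add: assms)

lemma block_cong:
  assumes "\<And>n. n < N * k \<Longrightarrow> u n = v n" "i < N"
  shows "block k u i = block k v i"
proof (rule nth_equalityI)
  fix j assume "j < length (block k u i)"
  then have j: "j < k" by simp
  have "i * k + j < Suc i * k" using j by simp
  also have "\<dots> \<le> N * k" using assms(2) by (intro mult_le_mono1) simp
  finally show "block k u i ! j = block k v i ! j" using assms(1) j by (simp add: nth_block)
qed simp

lemma digits_eq_of_blocks_eq:
  assumes "0 < k" "\<And>i. i < N \<Longrightarrow> block k u i = block k v i" "n < N * k"
  shows "u n = v n"
proof -
  have "n div k < N" using assms(1,3) by (simp add: less_mult_imp_div_less)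
  then have "block k u (n div k) ! (n mod k) = block k v (n div k) ! (n mod k)" using assms(2) by simp
  then show ?thesis using assms(1) by (simp add: nth_block)
qed

lemma infinitely_many_ones_iff_blocks:
  assumes "0 < k"
  shows "(\<forall>n. \<exists>m>n. u m) \<longleftrightarrow> (\<forall>N. \<exists>i\<ge>N. True \<in> set (block k u i))"
proof
  assume L: "\<forall>n. \<exists>m>n. u m"
  show "\<forall>N. \<exists>i\<ge>N. True \<in> set (block k u i)"
  proof
    fix N
    obtain m where m: "m > N * k" "u m" using L by blast
    have "m div k \<ge> N" using m(1) assms by (simp add: less_eq_div_iff_mult_less_eq)
    moreover have "block k u (m div k) ! (m mod k)" using m(2) assms by (simp add: nth_block)
    then have "True \<in> set (block k u (m div k))"
      using assms by (metis length_block mod_less_divisor nth_mem)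
    ultimately show "\<exists>i\<ge>N. True \<in> set (block k u i)" by blast
  qed
next
  assume R: "\<forall>N. \<exists>i\<ge>N. True \<in> set (block k u i)"
  show "\<forall>n. \<exists>m>n. u m"
  proof
    fix n
    obtain i where i: "i \<ge> Suc n" "True \<in> set (block k u i)" using R by blast
    then obtain j where j: "j < k" "block k u i ! j" by (metis in_set_conv_nth length_block)
    have "n < i * k" using i(1) assms
      by (metis Suc_le_lessD less_le_trans mult.right_neutral mult_le_mono2 Suc_leI One_nat_def)
    then show "\<exists>m>n. u m" using j by (metis nth_block trans_less_add1)
  qed
qed

text \<open>For \<open>k \<ge> 2\<close> there are 2^k >= 4 candidates.\<close>

lemma ex_list_avoiding_two:
  assumes "k \<ge> 2"
  shows "\<exists>c :: bool list. length c = k \<and> c \<noteq> a \<and> c \<noteq> b"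
proof (rule ccontr)
  assume "\<not> ?thesis"
  then have "{c :: bool list. set c \<subseteq> UNIV \<and> length c = k} \<subseteq> {a, b}" by auto
  then have "card {c :: bool list. set c \<subseteq> UNIV \<and> length c = k} \<le> card {a, b}"
    by (intro card_mono) auto
  also have "\<dots> \<le> 2" by (simp add: card_insert_if)
  finally have "(2::nat) ^ k \<le> 2" using card_lists_length_eq[of "UNIV :: bool set" k] by simp
  moreover have "(2::nat) ^ 2 \<le> 2 ^ k" using assms by (intro power_increasing) auto
  ultimately show False by simp
qed

section \<open>The erased block and the description of the fibre by words\<close>

lemma w_eps_erased:
  assumes "erasing_block_subst k \<sigma>"
  shows "length (w_eps k \<sigma>) = k \<and> \<sigma> (w_eps k \<sigma>) = []"
  using assms unfolding erasing_block_subst_def w_eps_def by (rule theI')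

lemmas length_w_eps = w_eps_erased[THEN conjunct1]

lemma w_eps_iff:
  assumes "erasing_block_subst k \<sigma>" "length b = k"
  shows "\<sigma> b = [] \<longleftrightarrow> b = w_eps k \<sigma>"
  using w_eps_erased[OF assms(1)] assms unfolding erasing_block_subst_def by blast

text \<open>As \<open>y \<noteq> 0\<close>, the default value 0 of \<open>f_sigma\<close>
  contributes nothing, and \<open>tilde\<close> inverts \<open>bin_val\<close> on words with
  infinitely many ones. The periodic word of the erased block has image value 0, so it drops out by
  itself.\<close>

lemma f_sigma_fiber:
  assumes er: "erasing_block_subst k \<sigma>" and k: "0 < k" and y: "y \<noteq> 0"
  shows "f_sigma k \<sigma> -` {y} \<inter> {0..1} = bin_val ` {u. (\<forall>n. \<exists>m>n. u m) \<and> sigma_val k \<sigma> u = y}"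
proof (intro set_eqI iffI)
  fix x assume "x \<in> f_sigma k \<sigma> -` {y} \<inter> {0..1}"
  then have x: "0 < x" "x \<le> 1" "sigma_val k \<sigma> (tilde x) = y"
    using y by (auto simp: f_sigma_def split: if_splits)
  then show "x \<in> bin_val ` {u. (\<forall>n. \<exists>m>n. u m) \<and> sigma_val k \<sigma> u = y}"
    using tilde_expansion[OF x(1,2)] by (intro image_eqI[of _ _ "tilde x"]) auto
next
  fix x assume "x \<in> bin_val ` {u. (\<forall>n. \<exists>m>n. u m) \<and> sigma_val k \<sigma> u = y}"
  then obtain u where u: "x = bin_val u" "\<forall>n. \<exists>m>n. u m" "sigma_val k \<sigma> u = y" by blast
  have "0 < x" "x \<le> 1" "tilde x = u"
    using u bin_val_pos bin_val_le_1 tilde_bin_val by auto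
  moreover have "u \<noteq> (\<lambda>n. w_eps k \<sigma> ! (n mod k))"
  proof
    assume "u = (\<lambda>n. w_eps k \<sigma> ! (n mod k))"
    then have "u = word_of_blocks k (\<lambda>i. w_eps k \<sigma>)" by (simp add: word_of_blocks_def fun_eq_iff)
    then have "\<sigma> (block k u i) = []" for i
      using block_word_of_blocks[of "\<lambda>i. w_eps k \<sigma>" i k] length_w_eps[OF er] w_eps_iff[OF er] by simp
    then show False using u(3) y by (simp add: sigma_val_eq_block_val block_val_def)
  qed
  ultimately show "x \<in> f_sigma k \<sigma> -` {y} \<inter> {0..1}" using u(3) by (simp add: f_sigma_def)
qed

lemma nondyadic_sigma_val_infinite:
  assumes "\<not> dyadic_rational (sigma_val k \<sigma> u)"
  shows "infinite {i. \<sigma> (block k u i) \<noteq> []}"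
proof
  assume "finite {i. \<sigma> (block k u i) \<noteq> []}"
  then obtain n where n: "\<forall>i\<in>{i. \<sigma> (block k u i) \<noteq> []}. i < n"
    using finite_nat_set_iff_bounded by blast
  have "\<forall>i\<ge>n. \<sigma> (block k u i) = []" using n by (auto simp: not_less[symmetric])
  then show False using dyadic_block_val_eventually_Nil assms
    unfolding sigma_val_eq_block_val by metis
qed

text \<open>Nondyadicity turns equality of values into equality of digits, and skipping erased
  blocks leaves start positions unchanged.\<close>

lemma sigma_decomp_nonerased_blocks:
  assumes nd: "\<not> dyadic_rational (bin_val w)" and eq: "sigma_val k \<sigma> u = bin_val w"
  shows "sigma_decomp k \<sigma> w (\<lambda>j. block k u (enumerate {i. \<sigma> (block k u i) \<noteq> []} j))"
proof -
  let ?I = "{i. \<sigma> (block k u i) \<noteq> []}" and ?ws = "\<lambda>i. \<sigma> (block k u i)"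
  let ?e = "enumerate ?I"
  have inf: "infinite ?I" using nondyadic_sigma_val_infinite[of k \<sigma> u] nd eq by simp
  have ne: "?ws (?e j) \<noteq> []" for j using enumerate_in_set[OF inf] by blast
  have st: "start_pos ?ws (?e i) = start_pos (\<lambda>j. ?ws (?e j)) i" for i
    using range_enumerate[OF inf] by (intro start_pos_reindex strict_mono_enumerate[OF inf]) auto
  have "w (start_pos (\<lambda>j. ?ws (?e j)) i + j) = ?ws (?e i) ! j" if "j < length (?ws (?e i))" for i j
    using nondyadic_block_val_digits[of w ?ws j "?e i"] that nd eq st[of i]
    by (simp add: sigma_val_eq_block_val)
  then show ?thesis using ne by (simp add: sigma_decomp_def inf_concat_eq_def)
qed

lemma connected_real_interior_empty:
  fixes C S :: "real set"
  assumes "interior S = {}" "C \<subseteq> S" "connected C" "a \<in> C" "b \<in> C"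
  shows "a = b"
proof (rule ccontr)
  assume "a \<noteq> b"
  then obtain c d where cd: "c < d" "c \<in> C" "d \<in> C" using assms(4,5) by (metis linorder_neqE)
  then have "{c<..<d} \<subseteq> S" using connected_contains_Icc[OF assms(3)] assms(2) by fastforce
  then have "{c<..<d} \<subseteq> interior S" by (intro interior_maximal) auto
  then show False using cd(1) assms(1) by auto
qed

section \<open>The fibre\<close>

lemma sigma_fiber_nonempty:
  assumes er: "erasing_block_subst k \<sigma>" and k: "0 < k" and dec: "sigma_decomp k \<sigma> w b"
  shows "\<exists>u. (\<forall>n. \<exists>m>n. u m) \<and> sigma_val k \<sigma> u = bin_val w"
proof -
  let ?e = "w_eps k \<sigma>"
  \<comment> \<open>The word spelled by the blocks \<open>b i\<close> alone might end in zeros.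
    Interleaving the erased block repairs this: either it contains a one, or it is 0^k and every
    \<open>b i\<close>, being different from it, contains a one.\<close>
  define B where "B i = (if even i then b (i div 2) else ?e)" for i
  define u where "u = word_of_blocks k B"
  have b: "length (b i) = k" "\<sigma> (b i) \<noteq> []" for i using dec by (auto simp: sigma_decomp_def)
  have blk: "block k u i = B i" for i
    unfolding u_def by (rule block_word_of_blocks) (simp add: B_def b length_w_eps[OF er])
  have "\<exists>i\<ge>N. True \<in> set (B i)" for N
  proof (cases "True \<in> set ?e")
    case True
    then show ?thesis by (intro exI[of _ "2 * N + 1"]) (simp add: B_def)
  next
    case False
    have "b N \<noteq> ?e" using b[of N] w_eps_iff[OF er b(1)] by blast
    moreover have "b N = ?e" if "True \<notin> set (b N)"
      using that False b(1) length_w_eps[OF er]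
      by (metis (full_types) nth_equalityI nth_mem)
    ultimately show ?thesis by (intro exI[of _ "2 * N"]) (auto simp: B_def)
  qed
  then have ones: "\<forall>n. \<exists>m>n. u m" using infinitely_many_ones_iff_blocks[OF k] blk by simp
  have "block_val (\<lambda>j. \<sigma> (B (2 * j))) = block_val (\<lambda>i. \<sigma> (B i))"
  proof (rule block_val_reindex)
    show "strict_mono (\<lambda>j::nat. 2 * j)" by (simp add: strict_mono_def)
    show "\<sigma> (B n) = []" if "n \<notin> range ((*) 2)" for n
      using that w_eps_iff[OF er length_w_eps[OF er]] by (auto simp: B_def elim!: evenE)
  qed
  then have "sigma_val k \<sigma> u = block_val (\<lambda>j. \<sigma> (b j))"
    by (simp add: sigma_val_eq_block_val blk) (simp add: B_def)
  also have "\<dots> = bin_val w"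
    using dec by (intro block_val_inf_concat_eq) (simp add: sigma_decomp_def)
  finally show ?thesis using ones by blast
qed

text \<open>Supplies fibre points near \<open>u\<close>. Block \<open>N\<close> is taken nonerased
  so that the insertion is already visible at that block.\<close>

lemma sigma_fiber_insert_erased_block:
  assumes er: "erasing_block_subst k \<sigma>" and k: "0 < k"
    and ones: "\<forall>n. \<exists>m>n. u m" and N: "\<sigma> (block k u N) \<noteq> []"
  shows "\<exists>v. (\<forall>n. \<exists>m>n. v m) \<and> sigma_val k \<sigma> v = sigma_val k \<sigma> u \<and> v \<noteq> u \<and> (\<forall>n<N * k. v n = u n)"
proof -
  let ?e = "w_eps k \<sigma>"
  define B where "B i = (if i < N then block k u i else if i = N then ?e else block k u (i - 1))" for i
  define v where "v = word_of_blocks k B"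
  \<comment> \<open>Enumerates the indices other than \<open>N\<close>, where the erased block sits.
    Since \<open>g i \<ge> i\<close>, blocks of \<open>u\<close> containing a one still occur
    arbitrarily far out.\<close>
  define g where "g i = (if i < N then i else Suc i)" for i
  have blk: "block k v i = B i" for i
    unfolding v_def by (rule block_word_of_blocks) (simp add: B_def length_w_eps[OF er])
  have Bg: "B (g i) = block k u i" for i by (simp add: B_def g_def)
  have eps: "\<sigma> ?e = []" using w_eps_iff[OF er length_w_eps[OF er]] by simp
  have "\<exists>i\<ge>M. True \<in> set (B i)" for M
  proof -
    obtain i where "i \<ge> M" "True \<in> set (block k u i)"
      using ones infinitely_many_ones_iff_blocks[OF k] by blast
    then show ?thesis using Bg[of i] by (intro exI[of _ "g i"]) (auto simp: g_def)
  qed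
  then have "\<forall>n. \<exists>m>n. v m" using infinitely_many_ones_iff_blocks[OF k] blk by simp
  moreover have "block_val (\<lambda>i. \<sigma> (B (g i))) = block_val (\<lambda>i. \<sigma> (B i))"
  proof (rule block_val_reindex)
    show "strict_mono g" by (simp add: strict_mono_def g_def)
    show "\<sigma> (B n) = []" if "n \<notin> range g" for n
    proof -
      have "n = N"
      proof (rule ccontr)
        assume "n \<noteq> N"
        then have "n = g (if n < N then n else n - 1)" by (auto simp: g_def)
        then show False using that by blast
      qed
      then show ?thesis using eps by (simp add: B_def)
    qed
  qed
  then have "sigma_val k \<sigma> v = sigma_val k \<sigma> u" by (simp add: sigma_val_eq_block_val blk Bg)
  moreover have "v \<noteq> u" using N eps blk[of N] by (auto simp: B_def)
  moreover have "v n = u n" if "n < N * k" for n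
    using digits_eq_of_blocks_eq[OF k _ that, of v u] blk by (simp add: B_def)
  ultimately show ?thesis by blast
qed

lemma sigma_fiber_islimpt:
  assumes er: "erasing_block_subst k \<sigma>" and k: "0 < k" and nd: "\<not> dyadic_rational y"
    and u: "\<forall>n. \<exists>m>n. u m" "sigma_val k \<sigma> u = y"
  shows "bin_val u islimpt bin_val ` {u. (\<forall>n. \<exists>m>n. u m) \<and> sigma_val k \<sigma> u = y}"
  unfolding islimpt_approachable
proof (intro allI impI)
  fix e :: real assume "e > 0"
  then obtain n where n: "1 / 2 ^ n < e"
    using real_arch_pow_inv[of e "1/2"] by (auto simp: power_divide)
  have "infinite {i. \<sigma> (block k u i) \<noteq> []}" using nondyadic_sigma_val_infinite[of k \<sigma> u] u(2) nd by simp
  then obtain N where N: "N \<ge> n" "\<sigma> (block k u N) \<noteq> []"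
    unfolding infinite_nat_iff_unbounded_le by blast
  obtain v where v: "\<forall>n. \<exists>m>n. v m" "sigma_val k \<sigma> v = y" "v \<noteq> u" "\<forall>n<N * k. v n = u n"
    using sigma_fiber_insert_erased_block[OF er k u(1) N(2)] u(2) by blast
  have "n \<le> N * k" using N(1) k by (metis le_trans mult.right_neutral mult_le_mono Suc_leI One_nat_def)
  then have "\<bar>bin_val v - bin_val u\<bar> \<le> 1 / 2 ^ n" using v(4) by (intro bin_val_diff_le) simp
  \<comment> \<open>Distinct words could share a value in general, but not when both have infinitely
    many ones.\<close>
  moreover have "bin_val v \<noteq> bin_val u"
    using v(1,3) u(1) bin_val_inj_infinitely_many_ones by blast
  ultimately show "\<exists>x'\<in>bin_val ` {u. (\<forall>n. \<exists>m>n. u m) \<and> sigma_val k \<sigma> u = y}.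
      x' \<noteq> bin_val u \<and> dist x' (bin_val u) < e"
    using n v(1,2) by (intro bexI[of _ "bin_val v"]) (auto simp: dist_real_def)
qed

text \<open>Equal blocks before \<open>N\<close> contain equally many nonerased ones, so block
  \<open>N\<close> has the same rank in both words and is the same entry of the unique decomposition
  of \<open>w\<close>.\<close>

lemma nonerased_block_determined:
  assumes nd: "\<not> dyadic_rational (bin_val w)"
    and uniq: "\<And>b b'. sigma_decomp k \<sigma> w b \<Longrightarrow> sigma_decomp k \<sigma> w b' \<Longrightarrow> b = b'"
    and u: "sigma_val k \<sigma> u = bin_val w" and v: "sigma_val k \<sigma> v = bin_val w"
    and pre: "\<And>i. i < N \<Longrightarrow> block k u i = block k v i"
    and N: "\<sigma> (block k u N) \<noteq> []" "\<sigma> (block k v N) \<noteq> []"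
  shows "block k u N = block k v N"
proof -
  let ?I = "\<lambda>u. {i. \<sigma> (block k u i) \<noteq> []}"
  let ?m = "card (?I u \<inter> {..<N})"
  have inf: "infinite (?I u)" "infinite (?I v)"
    using nondyadic_sigma_val_infinite[of k \<sigma>] nd u v by simp_all
  have "?I u \<inter> {..<N} = ?I v \<inter> {..<N}" using pre by auto
  then have m: "enumerate (?I u) ?m = N" "enumerate (?I v) ?m = N"
    using enumerate_card_below[OF inf(1), of N] enumerate_card_below[OF inf(2), of N] N by auto
  from fun_cong[OF uniq[OF sigma_decomp_nonerased_blocks[OF nd u] sigma_decomp_nonerased_blocks[OF nd v]],
      of ?m]
  show ?thesis using m by simp
qed

text \<open>A point of the closure need not lie in the fibre, so the contradiction comes from a
  fibre point \<open>v\<close> close to a point \<open>z\<close> of the forbidden cylinder; as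
  \<open>z\<close> is nondyadic, closeness forces common leading digits.\<close>

lemma sigma_fiber_nowhere_dense:
  assumes er: "erasing_block_subst k \<sigma>" and k: "k \<ge> 2" and nd: "\<not> dyadic_rational (bin_val w)"
    and uniq: "\<And>b b'. sigma_decomp k \<sigma> w b \<Longrightarrow> sigma_decomp k \<sigma> w b' \<Longrightarrow> b = b'"
  shows "interior (closure (bin_val ` {u. (\<forall>n. \<exists>m>n. u m) \<and> sigma_val k \<sigma> u = bin_val w})) = {}"
    (is "interior (closure ?X) = {}")
proof (rule ccontr)
  let ?J = "interior (closure ?X)"
  assume "?J \<noteq> {}"
  \<comment> \<open>An open set that meets a closure meets the set itself, so \<open>u\<close> can
    be taken in the fibre.\<close>
  moreover have "?J \<inter> closure ?X = ?J" using interior_subset by blast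
  ultimately have "?J \<inter> ?X \<noteq> {}"
    using open_Int_closure_eq_empty[OF open_interior, of "closure ?X" ?X] by simp
  then obtain u where u: "sigma_val k \<sigma> u = bin_val w" and uJ: "bin_val u \<in> ?J" by blast
  obtain e where e: "e > 0" "ball (bin_val u) e \<subseteq> ?J"
    using uJ open_interior openE by blast
  obtain n where n: "1 / 2 ^ n < e"
    using real_arch_pow_inv[of e "1/2"] e(1) by (auto simp: power_divide)
  have "infinite {i. \<sigma> (block k u i) \<noteq> []}" using nondyadic_sigma_val_infinite[of k \<sigma> u] u nd by simp
  then obtain N where N: "N \<ge> n" "\<sigma> (block k u N) \<noteq> []"
    unfolding infinite_nat_iff_unbounded_le by blast
  obtain c where c: "length c = k" "c \<noteq> w_eps k \<sigma>" "c \<noteq> block k u N"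
    using ex_list_avoiding_two[OF k] by blast
  \<comment> \<open>Neither the erased block nor the only admissible nonerased one occurs at position N of z,
    and the tail w keeps z nondyadic, hence in the interior of its cylinder.\<close>
  define z where "z i = (if i < N * k then u i else if i < Suc N * k then c ! (i - N * k)
    else w (i - Suc N * k))" for i
  have "(\<lambda>i. z (i + Suc N * k)) = w" by (auto simp: z_def)
  then have "\<not> dyadic_rational (bin_val z)" using nd dyadic_bin_val_shift[of z "Suc N * k"] by metis
  then obtain \<delta> where \<delta>: "\<delta> > 0" "\<And>v. \<bar>bin_val v - bin_val z\<bar> < \<delta> \<Longrightarrow> \<forall>i<Suc N * k. v i = z i"
    using nondyadic_digits_locally_constant[of z "Suc N * k"] by blast
  have "n \<le> N * k" using N(1) k by (metis le_trans mult.right_neutral mult_le_mono one_le_numeral)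
  then have "\<bar>bin_val u - bin_val z\<bar> \<le> 1 / 2 ^ n" by (intro bin_val_diff_le) (simp add: z_def)
  then have "bin_val z \<in> ball (bin_val u) e" using n by (simp add: dist_real_def)
  then have "bin_val z \<in> closure ?X" using e(2) interior_subset by blast
  then obtain v where v: "sigma_val k \<sigma> v = bin_val w" "\<bar>bin_val v - bin_val z\<bar> < \<delta>"
    using \<delta>(1) unfolding closure_approachable dist_real_def by blast
  note vz = \<delta>(2)[OF v(2)]
  have vN: "block k v N = c"
  proof (rule nth_equalityI)
    fix j assume "j < length (block k v N)"
    then have j: "j < k" by simp
    then show "block k v N ! j = c ! j" using vz by (simp add: nth_block z_def)
  qed (simp add: c)
  have "block k u i = block k v i" if "i < N" for i
    using vz that by (intro block_cong[of N]) (simp_all add: z_def)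
  moreover have "\<sigma> (block k v N) \<noteq> []" using vN c w_eps_iff[OF er c(1)] by simp
  ultimately have "block k u N = block k v N"
    using nonerased_block_determined[OF nd uniq u v(1)] N(2) by blast
  then show False using vN c(3) by simp
qed

theorem mainTheorem6:
  fixes k :: nat and \<sigma> :: "bool list \<Rightarrow> bool list" and y :: real
  assumes "k \<ge> 2"
    and "erasing_block_subst k \<sigma>"
    and "w_eps k \<sigma> \<noteq> replicate k True"
    and "optimal k \<sigma>"
    and "y \<in> {0..1}"
    and "\<forall>w. y = bin_val w \<longrightarrow>
           (\<forall>b b'. sigma_decomp k \<sigma> w b \<and> sigma_decomp k \<sigma> w b' \<longrightarrow> b = b')"
    and "\<not> dyadic_rational y"
  shows "cantor_space (closure (f_sigma k \<sigma> -` {y} \<inter> {0..1}))"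
proof -
  let ?X = "bin_val ` {u. (\<forall>n. \<exists>m>n. u m) \<and> sigma_val k \<sigma> u = y}"
  have k: "0 < k" using assms(1) by simp
  \<comment> \<open>Zero is dyadic; hence \<open>y\<close> lies in (0,1], where an expansion exists,
    and avoids the default value of \<open>f_sigma\<close>.\<close>
  have y0: "y \<noteq> 0" using assms(7) dyadic_rational_of_int[of 0] by auto
  then obtain w where w: "y = bin_val w"
    using assms(5) ex_expansion_infinitely_many_ones[of y] by fastforce
  obtain b where "sigma_decomp k \<sigma> w b" using assms(4) by (auto simp: optimal_def)
  from sigma_fiber_nonempty[OF assms(2) k this] have "closure ?X \<noteq> {}" unfolding w by simp
  moreover have "bounded ?X"
    by (rule bounded_subset[of "{0..1}"]) (auto simp: bin_val_nonneg bin_val_le_1)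
  then have "compact (closure ?X)" by simp
  moreover have "x islimpt closure ?X" if "x \<in> closure ?X" for x
  proof -
    \<comment> \<open>Points of the closure outside the fibre are limit points by definition; those
      in the fibre are limit points by block insertion.\<close>
    have "x islimpt ?X"
      using that sigma_fiber_islimpt[OF assms(2) k assms(7)] by (auto simp: closure_def)
    then show ?thesis using closure_subset by (rule islimpt_subset)
  qed
  moreover have int: "interior (closure ?X) = {}"
    unfolding w
    using assms(6,7) by (intro sigma_fiber_nowhere_dense assms(1,2)) (auto simp: w)
  moreover have "\<forall>C\<subseteq>closure ?X. connected C \<longrightarrow> (\<forall>a\<in>C. \<forall>b\<in>C. a = b)"
    by (intro allI impI ballI) (rule connected_real_interior_empty[OF int])
  ultimately have "cantor_space (closure ?X)"
    unfolding cantor_space_def by (intro conjI ballI)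
  then show ?thesis by (simp only: f_sigma_fiber[OF assms(2) k y0])
qed

end
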